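(* Let $X_1,X_2,\dots$ be independent positive random variables with continuous (non-atomic) distribution functions $F_i(x)=P(X_i\le x)$, where $F_i(0)=0$ and $F_i(x)>0$ for all $x>0$. Put $\nu_i(x)=-\ln F_i(x)$ for $x>0$ and $\nu_i(0)=\infty$. Assume that: (1) for all $i\ge 1$, $$\nu_i(x)=c_i\,r(x)\,(1+\delta_i(x)),$$ where the $c_i$ are non-negative constants; $r(x)$ is a non-negative, continuous, non-increasing function with $r(0)=\infty$ and $r(\infty)=0$; the functions $\delta_i$ are continuous; $\delta_i(x)\to 0$ as $x\to\infty$ uniformly in $i$; and there are positive constants $M<\infty$ and $m<1$ such that $-m\le\delta_i(x)\le M$ for all $i$ and $x$; (2) $b_n:=\sum_{i=1}^n c_i\to\infty$ as $n\to\infty$. For $1\le i\le n$ set $p_{in}=P\{X_i=\max\{X_1,\dots,X_n\}\}$ and $\alpha_{in}=c_i/b_n$. Then, uniformly in $i$, $$p_{in}\sim\alpha_{in}\quad\text{as } n\to\infty.$$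
   Context: The symbol $\sim$ means that the ratio of the left- and right-hand sides converges to one. Here $r(\infty)=0$ means $r(x)\to0$ as $x\to\infty$, and $r(0)=\infty$ together with continuity means $r(x)\to\infty$ as $x\to0^+$. The quantity $p_{in}$ equals $P\{A_n=i\}$, where $A_n=\arg\max\{X_1,\dots,X_n\}$ is the index at which the maximum is attained; it is almost surely unique because the distributions are continuous.
   Formalization: r is assumed strictly positive on (0,∞) rather than only non-negative: if r vanishes from a finite point on, the condition δ_i(x)→0 as x→∞ no longer restricts the distributions and the claim can fail. *)

theory Defs
  imports "HOL-Probability.Probability"
begin

definition dist_fun :: "'a measure \<Rightarrow> ('a \<Rightarrow> real) \<Rightarrow> real \<Rightarrow> real"
  where "dist_fun P Y = cdf (distr P borel Y)"

text \<open>The value for negative arguments is irrelevant; \<open>\<infinity>\<close> is the natural continuation for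
  a positive random variable.\<close>
definition nu :: "'a measure \<Rightarrow> ('a \<Rightarrow> real) \<Rightarrow> real \<Rightarrow> ereal"
  where "nu P Y x = (if 0 < x then ereal (- ln (dist_fun P Y x)) else \<infinity>)"

definition max_prob :: "'a measure \<Rightarrow> (nat \<Rightarrow> 'a \<Rightarrow> real) \<Rightarrow> nat \<Rightarrow> nat \<Rightarrow> real"
  where "max_prob P X i n =
    measure P {\<omega> \<in> space P. X i \<omega> = Max ((\<lambda>j. X j \<omega>) ` {1..n})}"

definition partial_weight :: "(nat \<Rightarrow> real) \<Rightarrow> nat \<Rightarrow> real"
  where "partial_weight c n = (\<Sum>i = 1..n. c i)"

definition weight_ratio :: "(nat \<Rightarrow> real) \<Rightarrow> nat \<Rightarrow> nat \<Rightarrow> real"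
  where "weight_ratio c i n = c i / partial_weight c n"

text \<open>The index range \<open>{1..n}\<close> grows with \<open>n\<close>, so this is not an instance of \<open>uniform_limit\<close>
  over a fixed set.\<close>
definition uniformly_asymp_equiv :: "(nat \<Rightarrow> nat \<Rightarrow> real) \<Rightarrow> (nat \<Rightarrow> nat \<Rightarrow> real) \<Rightarrow> bool"
  where "uniformly_asymp_equiv p q \<longleftrightarrow>
    (\<forall>\<epsilon>>0. \<forall>\<^sub>F n in sequentially. \<forall>i\<in>{1..n}. \<bar>p i n / q i n - 1\<bar> < \<epsilon>)"

end

theory Submission
  imports Defs
begin

text \<open>
  By independence, \<open>p\<^sub>i\<^sub>n = E (\<Prod>j\<noteq>i. F\<^sub>j (X\<^sub>i))\<close>, and \<open>U = F\<^sub>i (X\<^sub>i)\<close> is uniform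
  on \<open>[0, 1]\<close>. Put \<open>S = (b\<^sub>n - c\<^sub>i) / c\<^sub>i\<close>. Where all \<open>\<bar>\<delta>\<^sub>j\<bar> \<le> \<epsilon>\<close>, that is for
  \<open>X\<^sub>i \<ge> x\<^sub>0\<close>, the product lies between \<open>U powr (K * S)\<close> and \<open>U powr (S / K)\<close> with
  \<open>K = (1 + \<epsilon>) / (1 - \<epsilon>)\<close>; everywhere it is at most \<open>U powr (k * S)\<close> with
  \<open>k = (1 - m) / (1 + M)\<close>. Since \<open>E (U powr s) = 1 / (s + 1)\<close> and \<open>S + 1 = b\<^sub>n / c\<^sub>i\<close>, the
  main term agrees with \<open>c\<^sub>i / b\<^sub>n\<close> up to a factor \<open>K\<close>. On \<open>X\<^sub>i < x\<^sub>0\<close> we have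
  \<open>U \<le> exp (- c\<^sub>i * (1 - m) * r x\<^sub>0)\<close>, so the contribution of this event, relative to
  \<open>c\<^sub>i / b\<^sub>n\<close>, is exponentially small in \<open>b\<^sub>n\<close>, uniformly in \<open>i\<close>.
\<close>

text \<open>Independence makes the joint law a product measure, and Fubini with coordinate
  \<open>i\<close> outermost leaves, for \<open>X i = x\<close>, the probability that all other
  coordinates are at most \<open>x\<close>. Ties count on both sides, since \<open>cdf\<close>
  measures the closed ray \<open>{..x}\<close>.\<close>

lemma (in prob_space) prob_indep_var_is_max:
  fixes X :: "'i \<Rightarrow> 'a \<Rightarrow> real"
  assumes indep: "indep_vars (\<lambda>_. borel) X I" and "finite I" and "i \<in> I"
  shows "prob {\<omega> \<in> space M. \<forall>j\<in>I. X j \<omega> \<le> X i \<omega>} =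
    (\<integral>x. (\<Prod>j\<in>I - {i}. cdf (distr M borel (X j)) x) \<partial>distr M borel (X i))"
proof -
  let ?D = "\<lambda>j. distr M borel (X j)"
  have rv: "j \<in> I \<Longrightarrow> X j \<in> borel_measurable M" for j
    using indep by (auto simp: indep_vars_def2)
  \<comment> \<open>\<open>product_prob_space N UNIV\<close> asks for a probability measure at every
    index, while \<open>X j\<close> is known to be measurable only for \<open>j \<in> I\<close>; a
    point mass fills the rest.\<close>
  define N where "N j = (if j \<in> I then ?D j else return borel 0)" for j
  have N: "prob_space (N j)" for j
    by (auto simp: N_def prob_space_return intro!: prob_space_distr rv)
  have sets_N [measurable_cong, simp]: "sets (N j) = sets borel" for j
    by (simp add: N_def)
  have [simp]: "space (N j) = UNIV" for j
    by (simp add: N_def)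
  interpret N: product_prob_space N UNIV
    using N by (intro product_prob_spaceI)
  define I' where "I' = I - {i}"
  have I': "finite I'" "i \<notin> I'" and I_eq: "I = insert i I'"
    using assms by (auto simp: I'_def)
  define A where "A = {f \<in> space (PiM I N). \<forall>j\<in>I. f j \<le> f i}"
  have A [measurable]: "A \<in> sets (PiM (insert i I') N)"
  proof -
    have "(\<lambda>f. f j) \<in> borel_measurable (PiM I N)" if "j \<in> I" for j
      using measurable_component_singleton[OF that, of N]
      by (subst measurable_cong_sets[OF refl sets_N[of j], symmetric])
    then show ?thesis
      unfolding A_def I_eq[symmetric] using assms
      by (intro sets.sets_Collect_finite_All' borel_measurable_le) auto
  qed
  have [measurable]: "cdf (N j) \<in> borel_measurable borel" for j
    by (intro borel_measurable_mono monoI finite_borel_measure.cdf_nondecreasing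
        finite_borel_measure.intro finite_borel_measure_axioms.intro)
       (auto intro: prob_space.finite_measure N)
  have "emeasure M {\<omega> \<in> space M. \<forall>j\<in>I. X j \<omega> \<le> X i \<omega>} =
      emeasure (distr M (PiM I (\<lambda>_. borel)) (\<lambda>\<omega>. \<lambda>j\<in>I. X j \<omega>)) A"
  proof -
    have "sets (PiM I N) = sets (PiM I (\<lambda>_. borel))"
      by (rule sets_PiM_cong) simp_all
    with A I_eq have *: "A \<in> sets (PiM I (\<lambda>_. borel))"
      by metis
    have "(\<lambda>\<omega>. \<lambda>j\<in>I. X j \<omega>) \<in> measurable M (PiM I (\<lambda>_. borel))"
      using rv by measurable
    from emeasure_distr[OF this *] show ?thesis
      using \<open>i \<in> I\<close> by (auto simp: A_def space_PiM intro!: arg_cong[where f="emeasure M"])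
  qed
  also have "\<dots> = emeasure (PiM I N) A"
  proof -
    have "I \<noteq> {}" using \<open>i \<in> I\<close> by auto
    then have "distr M (PiM I (\<lambda>_. borel)) (\<lambda>\<omega>. \<lambda>j\<in>I. X j \<omega>) = PiM I ?D"
      using indep_vars_iff_distr_eq_PiM'[where I = I and X = X and M' = "\<lambda>_. borel"] rv indep by blast
    also have "\<dots> = PiM I N"
      by (rule PiM_cong) (auto simp: N_def)
    finally show ?thesis by simp
  qed
  also have "\<dots> = (\<integral>\<^sup>+f. indicator A f \<partial>PiM (insert i I') N)"
    using A by (simp add: I_eq)
  also have "\<dots> = (\<integral>\<^sup>+x. \<integral>\<^sup>+f. indicator A (f(i := x)) \<partial>PiM I' N \<partial>N i)"
    using I' by (intro N.product_nn_integral_insert_rev) measurable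
  also have "\<dots> = (\<integral>\<^sup>+x. ennreal (\<Prod>j\<in>I'. cdf (N j) x) \<partial>N i)"
  proof (intro nn_integral_cong)
    fix x
    \<comment> \<open>With coordinate \<open>i\<close> fixed at \<open>x\<close>, the section of
      \<open>A\<close> is a box, whose product measure factorizes.\<close>
    have "(\<integral>\<^sup>+f. indicator A (f(i := x)) \<partial>PiM I' N) = (\<integral>\<^sup>+f. indicator (PiE I' (\<lambda>_. {..x})) f \<partial>PiM I' N)"
      using I' by (intro nn_integral_cong)
        (auto simp: A_def I_eq space_PiM PiE_iff extensional_def split: split_indicator)
    also have "\<dots> = emeasure (PiM I' N) (PiE I' (\<lambda>_. {..x}))"
      using I' by (intro nn_integral_indicator sets_PiM_I_finite) auto
    also have "\<dots> = (\<Prod>j\<in>I'. emeasure (N j) {..x})"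
      using I' by (intro N.emeasure_PiM) auto
    also have "\<dots> = ennreal (\<Prod>j\<in>I'. cdf (N j) x)"
      by (simp add: cdf_def prod_ennreal finite_measure.emeasure_eq_measure[OF prob_space.finite_measure[OF N]])
    finally show "(\<integral>\<^sup>+f. indicator A (f(i := x)) \<partial>PiM I' N) = ennreal (\<Prod>j\<in>I'. cdf (N j) x)" .
  qed
  also have "\<dots> = ennreal (\<integral>x. (\<Prod>j\<in>I'. cdf (N j) x) \<partial>N i)"
  proof (rule nn_integral_eq_integral)
    show "integrable (N i) (\<lambda>x. \<Prod>j\<in>I'. cdf (N j) x)"
    proof (rule finite_measure.integrable_const_bound[OF prob_space.finite_measure[OF N], where B = 1])
      show "AE x in N i. norm (\<Prod>j\<in>I'. cdf (N j) x) \<le> 1"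
        by (auto intro!: AE_I2 prod_le_1 simp: cdf_def abs_prod prob_space.prob_le_1[OF N])
    qed measurable
  qed (auto simp: cdf_def prod_nonneg)
  finally have "prob {\<omega> \<in> space M. \<forall>j\<in>I. X j \<omega> \<le> X i \<omega>} = (\<integral>x. (\<Prod>j\<in>I'. cdf (N j) x) \<partial>N i)"
    by (simp add: measure_def integral_nonneg prod_nonneg cdf_def)
  also have "\<dots> = (\<integral>x. (\<Prod>j\<in>I'. cdf (?D j) x) \<partial>?D i)"
    using \<open>i \<in> I\<close> by (intro Bochner_Integration.integral_cong prod.cong) (auto simp: N_def I'_def)
  finally show ?thesis
    by (simp add: I'_def)
qed

text \<open>Probability integral transform. For \<open>0 < u < 1\<close> continuity makes the
  sublevel set of \<open>cdf M\<close> at level \<open>u\<close> a closed ray \<open>{..z}\<close>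
  with \<open>cdf M z = u\<close>, so its probability is \<open>u\<close>.\<close>

lemma (in real_distribution) distr_cdf_uniform:
  assumes cont: "continuous_on UNIV (cdf M)"
  shows "distr M borel (cdf M) = uniform_measure lborel {0..1}"
proof (rule cdf_unique)
  have meas [measurable]: "cdf M \<in> borel_measurable borel"
    using cont by (rule borel_measurable_continuous_onI)
  have meas_M: "cdf M \<in> borel_measurable M"
    by (subst measurable_cong_sets[OF events_eq_borel refl]) (rule meas)
  show "real_distribution (distr M borel (cdf M))"
    by (rule real_distribution_distr[OF meas_M])
  interpret U: prob_space "uniform_measure lborel {0..1::real}"
    by (rule prob_space_uniform_measure) auto
  show "real_distribution (uniform_measure lborel {0..1::real})"
    by unfold_locales auto
  have cdf_U: "cdf (uniform_measure lborel {0..1::real}) u = min 1 (max 0 u)" for u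
  proof -
    have "{0..1} \<inter> {..u} = {0..min 1 u}" by auto
    then show ?thesis
      by (auto simp: cdf_def measure_def min_def max_def divide_ennreal[of _ 1, simplified])
  qed
  have mid: "prob {x. cdf M x \<le> u} = u" if u: "0 < u" "u < 1" for u
  proof -
    have "eventually (\<lambda>x. cdf M x < u) at_bot" "eventually (\<lambda>x. cdf M x > u) at_top"
      using order_tendstoD[OF cdf_lim_at_bot, of u] order_tendstoD[OF cdf_lim_at_top_prob, of u] u by auto
    then obtain a b where a: "\<And>x. x \<le> a \<Longrightarrow> cdf M x < u" and b: "\<And>x. x \<ge> b \<Longrightarrow> cdf M x > u"
      by (auto simp: eventually_at_bot_linorder eventually_at_top_linorder)
    have "a \<le> b"
      using a[of a] b[of a] by (cases "a \<le> b") auto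
    obtain y where y: "cdf M y = u"
      using IVT'[of "cdf M" a u b] a[of a] b[of b] \<open>a \<le> b\<close> continuous_on_subset[OF cont, of "{a..b}"]
      by (auto simp: less_imp_le)
    define S where "S = {x. cdf M x \<le> u}"
    have S: "S \<noteq> {}" "bdd_above S" "closed S"
      using y b unfolding S_def
      by (auto intro!: closed_Collect_le cont bdd_aboveI[where M = b]) (meson linorder_not_less nle_le)
    \<comment> \<open>\<open>cdf M\<close> may be constant to the right of \<open>y\<close>, so the
      largest point of the level set is taken instead.\<close>
    define z where "z = Sup S"
    have "z \<in> S" unfolding z_def by (rule closed_contains_Sup[OF S])
    have "y \<le> z" unfolding z_def using S y by (intro cSup_upper) (auto simp: S_def)
    have "cdf M z = u"
      using cdf_nondecreasing[OF \<open>y \<le> z\<close>] y \<open>z \<in> S\<close> by (auto simp: S_def)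
    have "S = {..z}"
    proof
      show "S \<subseteq> {..z}" unfolding z_def using S by (auto intro: cSup_upper)
      show "{..z} \<subseteq> S" using cdf_nondecreasing[of _ z] \<open>cdf M z = u\<close> by (auto simp: S_def)
    qed
    then show ?thesis
      using \<open>cdf M z = u\<close> by (simp add: cdf_def S_def)
  qed
  have vimage: "cdf (distr M borel (cdf M)) u = prob {x. cdf M x \<le> u}" for u
    by (simp add: cdf_def[of "distr _ _ _"] measure_distr[OF meas_M] vimage_def space_eq_univ)
  show "cdf (distr M borel (cdf M)) = cdf (uniform_measure lborel {0..1})"
  proof
    fix u :: real
    consider "u < 0" | "u = 0" | "0 < u" "u < 1" | "1 \<le> u" by linarith
    then show "cdf (distr M borel (cdf M)) u = cdf (uniform_measure lborel {0..1}) u"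
    proof cases
      case 1
      then have "{x. cdf M x \<le> u} = {}"
        using cdf_nonneg order_less_le_trans by (force simp: not_le)
      then show ?thesis using 1 by (simp add: vimage cdf_U)
    next
      case 2
      \<comment> \<open>The value 0 need not be attained by \<open>cdf M\<close>, so level 0 is
        reached through small positive levels.\<close>
      have "prob {x. cdf M x \<le> 0} \<le> e" if e: "0 < e" "e < 1" for e
      proof -
        have "prob {x. cdf M x \<le> 0} \<le> prob {x. cdf M x \<le> e}"
          using e by (intro finite_measure_mono) auto
        then show ?thesis using mid[OF e] by simp
      qed
      \<comment> \<open>The level \<open>1/2\<close> ensures that half of the probability is below
        1, hence an admissible \<open>e\<close>; a nonzero probability would then be at most its own
        half.\<close>
      from this[of "1/2"] this[of "prob {x. cdf M x \<le> 0} / 2"] have "prob {x. cdf M x \<le> 0} = 0"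
        using measure_nonneg[of M "{x. cdf M x \<le> 0}"] by linarith
      then show ?thesis
        using 2 by (simp add: vimage cdf_U)
    next
      case 3
      then show ?thesis by (simp add: vimage cdf_U mid)
    next
      case 4
      then have "{x. cdf M x \<le> u} = UNIV"
        using cdf_bounded_prob order_trans by auto
      then show ?thesis using 4 prob_space by (simp add: vimage cdf_U space_eq_univ)
    qed
  qed
qed

text \<open>By the uniform law of \<open>cdf M\<close>, this is the integral of
  \<open>v powr s\<close> over \<open>{0..u}\<close>. The case \<open>u = 1\<close> gives the full
  moment, smaller \<open>u\<close> the share of the lower tail.\<close>

lemma (in real_distribution) integral_cdf_powr:
  assumes cont: "continuous_on UNIV (cdf M)" and s: "0 \<le> s" and u: "0 \<le> u" "u \<le> 1"
  shows "(\<integral>x. indicator {..u} (cdf M x) * cdf M x powr s \<partial>M) = u powr (s + 1) / (s + 1)"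
proof -
  have meas [measurable]: "cdf M \<in> borel_measurable borel"
    using cont by (rule borel_measurable_continuous_onI)
  have meas_M: "cdf M \<in> borel_measurable M"
    by (subst measurable_cong_sets[OF events_eq_borel refl]) (rule meas)
  let ?f = "\<lambda>v::real. indicator {..u} v * v powr s"
  have f [measurable]: "?f \<in> borel_measurable borel" by measurable
  have "(\<integral>x. ?f (cdf M x) \<partial>M) = (\<integral>v. ?f v \<partial>uniform_measure lborel {0..1})"
    by (subst distr_cdf_uniform[OF cont, symmetric], rule integral_distr[OF meas_M f, symmetric])
  also have "\<dots> = enn2real (\<integral>\<^sup>+v. ennreal (?f v) \<partial>uniform_measure lborel {0..1})"
    by (rule integral_eq_nn_integral) auto
  also have "(\<integral>\<^sup>+v. ennreal (?f v) \<partial>uniform_measure lborel {0..1}) =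
      (\<integral>\<^sup>+v. ennreal (?f v) * indicator {0..1} v \<partial>lborel)"
    by (subst nn_integral_uniform_measure) (auto simp: divide_ennreal_def)
  also have "\<dots> = (\<integral>\<^sup>+v. ennreal (v powr s) * indicator {0..u} v \<partial>lborel)"
    using u by (intro nn_integral_cong) (auto split: split_indicator)
  also have "\<dots> = ennreal (u powr (s + 1) / (s + 1))"
    by (rule nn_integral_has_integral_lebesgue') (use has_integral_powr_from_0[of s u] s u in auto)
  finally show ?thesis
    using s by simp
qed


lemma (in real_distribution) integrable_indicator_cdf_powr:
  assumes "continuous_on UNIV (cdf M)" and "0 \<le> s"
  shows "integrable M (\<lambda>x. indicator {..u::real} (cdf M x) * cdf M x powr s)"
proof (rule integrable_const_bound[where B = 1])
  have [measurable]: "cdf M \<in> borel_measurable M"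
    using borel_measurable_continuous_onI[OF assms(1)]
    by (subst measurable_cong_sets[OF events_eq_borel refl])
  show "(\<lambda>x. indicator {..u} (cdf M x) * cdf M x powr s) \<in> borel_measurable M"
    by measurable
  show "AE x in M. norm (indicator {..u} (cdf M x) * cdf M x powr s) \<le> 1"
    using assms(2) by (auto intro!: AE_I2 powr_le1 simp: cdf_nonneg cdf_bounded_prob split: split_indicator)
qed

text \<open>Both terms of the bound are integrated by the moment formula. The exponent
  \<open>s\<close> serves the main region; the weaker exponent \<open>t\<close> has to serve only
  the lower tail \<open>cdf M x \<le> u\<close>.\<close>

lemma (in real_distribution) expectation_le_cdf_powr:
  assumes cont: "continuous_on UNIV (cdf M)" and "integrable M H"
    and s: "0 \<le> s" and t: "0 \<le> t" and u: "0 \<le> u" "u \<le> 1"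
    and le: "AE x in M. H x \<le> cdf M x powr s + indicator {..u} (cdf M x) * cdf M x powr t"
  shows "expectation H \<le> 1 / (s + 1) + u powr (t + 1) / (t + 1)"
proof -
  let ?f = "\<lambda>u s x. indicator {..u::real} (cdf M x) * cdf M x powr s"
  have "expectation H \<le> (\<integral>x. ?f 1 s x + ?f u t x \<partial>M)"
    using le assms(2) s t
    by (intro integral_mono_AE Bochner_Integration.integrable_add integrable_indicator_cdf_powr[OF cont])
      (auto simp: cdf_bounded_prob)
  also have "\<dots> = 1 / (s + 1) + u powr (t + 1) / (t + 1)"
    using s t u by (simp add: integrable_indicator_cdf_powr[OF cont] integral_cdf_powr[OF cont])
  finally show ?thesis .
qed

text \<open>On the lower tail \<open>cdf M x \<le> u\<close> the minorant vanishes, so that only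
  \<open>0 \<le> H x\<close> is asked for there; this costs the term
  \<open>u powr (s + 1)\<close>.\<close>

lemma (in real_distribution) expectation_ge_cdf_powr:
  assumes cont: "continuous_on UNIV (cdf M)" and "integrable M H"
    and s: "0 \<le> s" and u: "0 \<le> u" "u \<le> 1"
    and ge: "AE x in M. cdf M x powr s - indicator {..u} (cdf M x) * cdf M x powr s \<le> H x"
  shows "(1 - u powr (s + 1)) / (s + 1) \<le> expectation H"
proof -
  let ?f = "\<lambda>u s x. indicator {..u::real} (cdf M x) * cdf M x powr s"
  have "(1 - u powr (s + 1)) / (s + 1) = (\<integral>x. ?f 1 s x - ?f u s x \<partial>M)"
    using s u by (simp add: integrable_indicator_cdf_powr[OF cont] integral_cdf_powr[OF cont] diff_divide_distrib)
  also have "\<dots> \<le> expectation H"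
    using ge assms(2) s
    by (intro integral_mono_AE Bochner_Integration.integrable_diff integrable_indicator_cdf_powr[OF cont])
      (auto simp: cdf_bounded_prob)
  finally show ?thesis .
qed

theorem theorem1:
  fixes P :: "'a measure"
    and X :: "nat \<Rightarrow> 'a \<Rightarrow> real"
    and c :: "nat \<Rightarrow> real"
    and r :: "real \<Rightarrow> real"
    and \<delta> :: "nat \<Rightarrow> real \<Rightarrow> real"
    and m M :: real
  assumes prob: "prob_space P"
    and indep: "prob_space.indep_vars P (\<lambda>_. borel) X {1..}"
    and X_pos: "\<And>i. 1 \<le> i \<Longrightarrow> AE \<omega> in P. 0 < X i \<omega>"
    and F_cont: "\<And>i. 1 \<le> i \<Longrightarrow> continuous_on UNIV (dist_fun P (X i))"
    and F_zero: "\<And>i. 1 \<le> i \<Longrightarrow> dist_fun P (X i) 0 = 0"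
    and F_pos: "\<And>i x. 1 \<le> i \<Longrightarrow> 0 < x \<Longrightarrow> 0 < dist_fun P (X i) x"
    and nu_eq: "\<And>i x. 1 \<le> i \<Longrightarrow> 0 < x \<Longrightarrow>
                  nu P (X i) x = ereal (c i * r x * (1 + \<delta> i x))"
    and c_nonneg: "\<And>i. 1 \<le> i \<Longrightarrow> 0 \<le> c i"
    and r_pos: "\<And>x. 0 < x \<Longrightarrow> 0 < r x"
    and r_cont: "continuous_on {0<..} r"
    and r_mono: "antimono_on {0<..} r"
    and r_zero: "filterlim r at_top (at_right 0)"
    and r_infinity: "(r \<longlongrightarrow> 0) at_top"
    and \<delta>_cont: "\<And>i. 1 \<le> i \<Longrightarrow> continuous_on {0<..} (\<delta> i)"
    and \<delta>_lim: "uniform_limit {1..} (\<lambda>x i. \<delta> i x) (\<lambda>_. 0) at_top"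
    and m_bounds: "0 < m" "m < 1"
    and M_pos: "0 < M"
    and \<delta>_bounds: "\<And>i x. 1 \<le> i \<Longrightarrow> 0 < x \<Longrightarrow> - m \<le> \<delta> i x \<and> \<delta> i x \<le> M"
    and b_infinity: "filterlim (partial_weight c) at_top sequentially"
  shows "uniformly_asymp_equiv (max_prob P X) (weight_ratio c)"
proof -
  interpret prob_space P by (rule prob)
  let ?F = "\<lambda>i. dist_fun P (X i)" and ?b = "partial_weight c"
  have rv: "X i \<in> borel_measurable P" if "1 \<le> i" for i
    using indep that by (auto simp: indep_vars_def2)

  \<comment> \<open>Explicit form of the distribution functions and positivity of the
    weights\<close>
  have F_exp: "?F i x = exp (- (c i * r x * (1 + \<delta> i x)))" if "1 \<le> i" "0 < x" for i x
  proof -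
    have "- ln (?F i x) = c i * r x * (1 + \<delta> i x)"
      using nu_eq[OF that] that by (simp add: nu_def)
    then show ?thesis
      using F_pos[OF that] by (metis exp_ln minus_minus)
  qed
  \<comment> \<open>If \<open>c i = 0\<close> then \<open>F\<^sub>i\<close> jumps from 0 to 1 at 0; so the quotient below is never \<open>x / 0\<close>.\<close>
  have c_pos: "0 < c i" if i: "1 \<le> i" for i
  proof (rule ccontr)
    assume "\<not> 0 < c i"
    then have "c i = 0" using c_nonneg[OF i] by simp
    then have "eventually (\<lambda>x. ?F i x = 1) (at_right 0)"
      using F_exp[OF i] by (auto simp: eventually_at_filter)
    then have "(?F i \<longlongrightarrow> 1) (at_right 0)"
      by (rule tendsto_eventually)
    moreover have "(?F i \<longlongrightarrow> ?F i 0) (at_right 0)"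
      using F_cont[OF i] by (auto simp: continuous_on_eq_continuous_within continuous_within intro: tendsto_within_subset)
    ultimately have "?F i 0 = 1"
      by (intro tendsto_unique[of "at_right (0::real)"]) auto
    then show False using F_zero[OF i] by simp
  qed
  \<comment> \<open>The least value that the bounds \<open>- m\<close> and \<open>M\<close> allow
    for \<open>(1 + \<delta> j x) / (1 + \<delta> i x)\<close>.\<close>
  define k where "k = (1 - m) / (1 + M)"
  have k: "0 < k" "k < 1" using m_bounds M_pos by (auto simp: k_def divide_simps)
  \<comment> \<open>Neither outer bound contains \<open>i\<close>: this is where the uniformity in
    the final limit comes from.\<close>
  have bounds: "max_prob P X i n / weight_ratio c i n \<le> K + exp (- (r x\<^sub>0 * (1 - m) * k * ?b n)) / k
      \<and> (1 - exp (- (r x\<^sub>0 * (1 - m) * ?b n))) / K \<le> max_prob P X i n / weight_ratio c i n"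
    if \<epsilon>: "0 < \<epsilon>" "\<epsilon> < 1" and K: "K = (1 + \<epsilon>) / (1 - \<epsilon>)" and x\<^sub>0: "0 < x\<^sub>0"
      and \<delta>_small: "\<And>j x. 1 \<le> j \<Longrightarrow> x\<^sub>0 \<le> x \<Longrightarrow> \<bar>\<delta> j x\<bar> \<le> \<epsilon>" and i: "i \<in> {1..n}"
    for \<epsilon> K x\<^sub>0 n i
  proof -
    have i1: "1 \<le> i" using i by simp

    \<comment> \<open>Winning probability as an integral over the law of \<open>X i\<close>\<close>
    define D where "D = distr P borel (X i)"
    interpret D: real_distribution D
      unfolding D_def by (rule real_distribution_distr[OF rv[OF i1]])
    have cdf_D: "cdf D = ?F i" by (simp add: D_def dist_fun_def)
    have cont: "continuous_on UNIV (cdf D)" unfolding cdf_D by (rule F_cont[OF i1])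
    define J where "J = {1..n} - {i}"
    have J: "finite J" "\<And>j. j \<in> J \<Longrightarrow> 1 \<le> j" by (auto simp: J_def)
    define H where "H x = (\<Prod>j\<in>J. ?F j x)" for x
    have p: "max_prob P X i n = D.expectation H"
    proof -
      have "X i \<omega> = Max ((\<lambda>j. X j \<omega>) ` {1..n}) \<longleftrightarrow> (\<forall>j\<in>{1..n}. X j \<omega> \<le> X i \<omega>)" for \<omega>
        using i by (subst eq_commute, subst Max_eq_iff) auto
      then have "max_prob P X i n = prob {\<omega> \<in> space P. \<forall>j\<in>{1..n}. X j \<omega> \<le> X i \<omega>}"
        by (simp add: max_prob_def)
      also have "\<dots> = D.expectation H"
        unfolding D_def H_def J_def dist_fun_def using i
        by (intro prob_indep_var_is_max indep_vars_subset[OF indep]) auto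
      finally show ?thesis .
    qed
    have F_le1: "?F j x \<le> 1" and F_ge0: "0 \<le> ?F j x" if "1 \<le> j" for j x
      using real_distribution.cdf_bounded_prob[OF real_distribution_distr[OF rv[OF that]]]
      by (simp_all add: dist_fun_def cdf_def)
    have H_int: "integrable D H"
    proof (rule D.integrable_const_bound[where B = 1])
      have "H \<in> borel_measurable borel"
        unfolding H_def using J by (intro borel_measurable_prod borel_measurable_continuous_onI F_cont) auto
      then show "H \<in> borel_measurable D"
        by (subst measurable_cong_sets[OF D.events_eq_borel refl])
      show "AE x in D. norm (H x) \<le> 1"
        using J F_le1 F_ge0 by (auto intro!: AE_I2 prod_le_1 simp: H_def abs_prod)
    qed
    \<comment> \<open>The formula for \<open>nu\<close> and the bounds on \<open>\<delta>\<close>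
      hold only at positive arguments; almost surely no others occur.\<close>
    have D_pos: "AE x in D. 0 < x"
      unfolding D_def using X_pos[OF i1] rv[OF i1] by (subst AE_distr_iff) auto
    have ci: "0 < c i" by (rule c_pos[OF i1])
    \<comment> \<open>\<open>B\<close> is the reciprocal of \<open>weight_ratio c i n\<close>, and
      \<open>S\<close> is the total weight of the competitors relative to
      \<open>c i\<close>.\<close>
    define B where "B = ?b n / c i"
    define S where "S = sum c J / c i"
    have "?b n = c i + sum c J"
      unfolding partial_weight_def J_def using i by (simp add: sum.remove)
    then have S: "S + 1 = B" and S_ge0: "0 \<le> S"
      using ci J c_nonneg by (auto simp: B_def S_def add_divide_distrib intro!: divide_nonneg_pos sum_nonneg)
    have B: "1 \<le> B" using S S_ge0 by simp

    \<comment> \<open>Comparison of the product with powers of one distribution function\<close>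
    have H_exp: "H x = exp (- (\<Sum>j\<in>J. c j * r x * (1 + \<delta> j x)))" if "0 < x" for x
      using J F_exp that by (simp add: H_def exp_sum sum_negf[symmetric])
    have F_powr: "cdf D x powr s = exp (- (s * (c i * r x * (1 + \<delta> i x))))" if "0 < x" for x s
      using F_exp[OF i1 that] by (simp add: cdf_D powr_def)
    \<comment> \<open>Spreading the exponent over \<open>J\<close> gives the same shape as
      \<open>H_exp\<close>, so comparing with \<open>H\<close> reduces to comparing
      \<open>l * (1 + \<delta> i x)\<close> with \<open>1 + \<delta> j x\<close> term by
      term.\<close>
    have F_powr_S: "cdf D x powr (l * S) = exp (- (\<Sum>j\<in>J. c j * r x * (l * (1 + \<delta> i x))))" if "0 < x" for x l
    proof -
      have "(\<Sum>j\<in>J. c j * r x * (l * (1 + \<delta> i x))) = sum c J * (l * (r x * (1 + \<delta> i x)))"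
        by (simp only: sum_distrib_right) (simp add: mult_ac)
      then show ?thesis
        using ci by (simp add: F_powr[OF that] S_def mult_ac)
    qed
    have H_le: "H x \<le> cdf D x powr (l * S)"
      if "0 < x" "\<And>j. j \<in> J \<Longrightarrow> l * (1 + \<delta> i x) \<le> 1 + \<delta> j x" for x l
      unfolding H_exp[OF that(1)] F_powr_S[OF that(1)] using that J c_nonneg less_imp_le[OF r_pos]
      by (auto intro!: sum_mono mult_left_mono)
    have H_ge: "cdf D x powr (l * S) \<le> H x"
      if "0 < x" "\<And>j. j \<in> J \<Longrightarrow> 1 + \<delta> j x \<le> l * (1 + \<delta> i x)" for x l
      unfolding H_exp[OF that(1)] F_powr_S[OF that(1)] using that J c_nonneg less_imp_le[OF r_pos]
      by (auto intro!: sum_mono mult_left_mono)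
    have K1: "1 \<le> K" using \<epsilon> by (simp add: K divide_simps)
    \<comment> \<open>By monotonicity the event \<open>cdf D x \<le> u\<close> covers the region
      \<open>x < x\<^sub>0\<close>, and it is an event about the uniform variable alone.\<close>
    define u where "u = cdf D x\<^sub>0"
    have u: "0 \<le> u" "u \<le> 1" by (simp_all add: u_def D.cdf_nonneg D.cdf_bounded_prob)
    \<comment> \<open>The exponent of \<open>u\<close> contains the factor \<open>c i\<close>, which
      cancels against \<open>B = ?b n / c i\<close>; what remains is exponentially small in
      \<open>?b n\<close> and free of \<open>i\<close>.\<close>
    have u_powr: "u powr t \<le> exp (- (r x\<^sub>0 * (1 - m) * l * ?b n))" if "0 \<le> l" "l * B \<le> t" for t l
    proof -
      have "u powr t \<le> u powr (l * B)"
        using that u by (intro powr_mono') auto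
      also have "\<dots> = exp (- (r x\<^sub>0 * (1 + \<delta> i x\<^sub>0) * l * ?b n))"
        unfolding u_def F_powr[OF x\<^sub>0] using ci by (simp add: B_def mult_ac)
      also have "\<dots> \<le> exp (- (r x\<^sub>0 * (1 - m) * l * ?b n))"
        using \<delta>_bounds[OF i1 x\<^sub>0] r_pos[OF x\<^sub>0] that ci B
        by (auto intro!: mult_right_mono mult_left_mono simp: B_def)
      finally show ?thesis .
    qed
    have below: "cdf D x \<le> u" if "x < x\<^sub>0" for x
      using that by (simp add: u_def D.cdf_nondecreasing)

    \<comment> \<open>Upper bound\<close>
    have "D.expectation H \<le> 1 / (1 / K * S + 1) + u powr (k * S + 1) / (k * S + 1)"
    proof (rule D.expectation_le_cdf_powr[OF cont H_int _ _ u])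
      show "AE x in D. H x \<le> cdf D x powr (1 / K * S) + indicator {..u} (cdf D x) * cdf D x powr (k * S)"
        using D_pos
      proof eventually_elim
        case (elim x)
        show ?case
        proof (cases "x < x\<^sub>0")
          case True
          have "H x \<le> cdf D x powr (k * S)"
          proof (rule H_le[OF elim])
            fix j assume "j \<in> J"
            have "k * (1 + \<delta> i x) \<le> k * (1 + M)"
              using k \<delta>_bounds[OF i1 elim] by (intro mult_left_mono) auto
            also have "\<dots> = 1 - m" using M_pos by (simp add: k_def)
            also have "\<dots> \<le> 1 + \<delta> j x" using \<delta>_bounds[OF J(2)[OF \<open>j \<in> J\<close>] elim] by simp
            finally show "k * (1 + \<delta> i x) \<le> 1 + \<delta> j x" .
          qed
          then show ?thesis using below[OF True] by (simp add: add_increasing)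
        next
          case False
          have "H x \<le> cdf D x powr (1 / K * S)"
          proof (rule H_le[OF elim])
            fix j assume "j \<in> J"
            \<comment> \<open>From \<open>x\<^sub>0\<close> on, the ratio of the two factors is at
              least \<open>(1 - \<epsilon>) / (1 + \<epsilon>) = 1 / K\<close>.\<close>
            have "1 / K * (1 + \<delta> i x) \<le> 1 / K * (1 + \<epsilon>)"
              using K1 \<delta>_small[OF i1, of x] False by (intro mult_left_mono) auto
            also have "\<dots> = 1 - \<epsilon>" using \<epsilon> by (simp add: K)
            also have "\<dots> \<le> 1 + \<delta> j x" using \<delta>_small[OF J(2)[OF \<open>j \<in> J\<close>], of x] False by simp
            finally show "1 / K * (1 + \<delta> i x) \<le> 1 + \<delta> j x" .
          qed
          then show ?thesis by (simp add: add_increasing2)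
        qed
      qed
    qed (use K1 k S_ge0 in auto)
    also have "\<dots> \<le> 1 / (1 / K * B) + exp (- (r x\<^sub>0 * (1 - m) * k * ?b n)) / (k * B)"
    proof -
      \<comment> \<open>Since \<open>B = S + 1\<close> and both \<open>1 / K\<close> and
        \<open>k\<close> are at most 1, the denominators shrink to multiples of \<open>B\<close>,
        which cancels when the bound is multiplied by \<open>B\<close>.\<close>
      have "1 / K * B \<le> 1 / K * S + 1" "k * B \<le> k * S + 1"
        using K1 k by (simp_all add: S[symmetric] distrib_left add_divide_distrib)
      then show ?thesis
        using K1 k B by (intro add_mono frac_le u_powr) (auto intro: order_trans)
    qed
    finally have up: "D.expectation H * B \<le> K + exp (- (r x\<^sub>0 * (1 - m) * k * ?b n)) / k"
      using B K1 k by (simp add: field_simps)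

    \<comment> \<open>Lower bound\<close>
    have "(1 - u powr (K * S + 1)) / (K * S + 1) \<le> D.expectation H"
    proof (rule D.expectation_ge_cdf_powr[OF cont H_int _ u])
      show "AE x in D. cdf D x powr (K * S) - indicator {..u} (cdf D x) * cdf D x powr (K * S) \<le> H x"
        using D_pos
      proof eventually_elim
        case (elim x)
        have "0 \<le> H x" by (simp add: H_exp[OF elim])
        show ?case
        proof (cases "x < x\<^sub>0")
          case True
          then show ?thesis using below[OF True] \<open>0 \<le> H x\<close> by simp
        next
          case False
          have "cdf D x powr (K * S) \<le> H x"
          proof (rule H_ge[OF elim])
            fix j assume "j \<in> J"
            have "1 + \<delta> j x \<le> 1 + \<epsilon>" using \<delta>_small[OF J(2)[OF \<open>j \<in> J\<close>], of x] False by simp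
            also have "\<dots> = K * (1 - \<epsilon>)" using \<epsilon> by (simp add: K)
            also have "\<dots> \<le> K * (1 + \<delta> i x)"
              using K1 \<delta>_small[OF i1, of x] False by (intro mult_left_mono) auto
            finally show "1 + \<delta> j x \<le> K * (1 + \<delta> i x)" .
          qed
          then show ?thesis using \<open>0 \<le> H x\<close> by (auto split: split_indicator)
        qed
      qed
    qed (use K1 S_ge0 in auto)
    \<comment> \<open>Now \<open>1 \<le> K\<close> enlarges the denominator to \<open>K * B\<close>,
      and \<open>B \<le> K * S + 1\<close> lets \<open>u_powr\<close> apply with
      \<open>l = 1\<close>.\<close>
    moreover have "(1 - exp (- (r x\<^sub>0 * (1 - m) * ?b n))) / (K * B) \<le> (1 - u powr (K * S + 1)) / (K * S + 1)"
    proof (rule frac_le)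
      have "S \<le> K * S" using K1 S_ge0 by (simp add: mult_le_cancel_right1)
      then show "1 - exp (- (r x\<^sub>0 * (1 - m) * ?b n)) \<le> 1 - u powr (K * S + 1)"
        using u_powr[of 1 "K * S + 1"] by (simp add: S[symmetric])
      show "K * S + 1 \<le> K * B" using K1 by (simp add: S[symmetric] distrib_left)
      show "0 \<le> 1 - u powr (K * S + 1)"
        using u K1 S_ge0 by (simp add: powr_le1)
      show "0 < K * S + 1" using K1 S_ge0 by (simp add: add_nonneg_pos)
    qed
    ultimately have "(1 - exp (- (r x\<^sub>0 * (1 - m) * ?b n))) / (K * B) \<le> D.expectation H" by linarith
    then have "(1 - exp (- (r x\<^sub>0 * (1 - m) * ?b n))) / K \<le> D.expectation H * B"
      using B K1 by (simp add: field_simps)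
    moreover have "max_prob P X i n / weight_ratio c i n = D.expectation H * B"
      by (simp add: p weight_ratio_def B_def)
    ultimately show ?thesis using up by simp
  qed

  \<comment> \<open>Passage to the limit\<close>
  have exp_b: "(\<lambda>n. exp (- (a * ?b n))) \<longlonglongrightarrow> 0" if "0 < a" for a
    by (rule filterlim_compose[OF exp_at_bot])
       (use that in \<open>auto simp: filterlim_uminus_at_bot intro!: filterlim_tendsto_pos_mult_at_top[OF tendsto_const _ b_infinity]\<close>)
  show ?thesis
    unfolding uniformly_asymp_equiv_def
  proof (intro allI impI)
    fix e :: real assume e: "0 < e"
    \<comment> \<open>Chosen so that \<open>(1 + \<epsilon>) / (1 - \<epsilon>)\<close> is exactly
      \<open>1 + e / 2\<close>; the other \<open>e / 2\<close> is left for the exponential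
      term.\<close>
    define \<epsilon> where "\<epsilon> = e / (4 + e)"
    define K where "K = 1 + e / 2"
    have \<epsilon>: "0 < \<epsilon>" "\<epsilon> < 1" and K: "K = (1 + \<epsilon>) / (1 - \<epsilon>)"
      using e by (auto simp: \<epsilon>_def K_def field_simps)
    have "eventually (\<lambda>x. \<forall>j\<in>{1..}. dist (\<delta> j x) 0 < \<epsilon>) at_top"
      using \<delta>_lim \<epsilon>(1) by (rule uniform_limitD)
    then obtain y where y: "\<And>x j. y \<le> x \<Longrightarrow> 1 \<le> j \<Longrightarrow> \<bar>\<delta> j x\<bar> < \<epsilon>"
      by (auto simp: eventually_at_top_linorder)
    \<comment> \<open>The threshold \<open>y\<close> may be negative or 0, whereas \<open>r\<close>
      and \<open>\<delta>\<close> are controlled only at positive arguments.\<close>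
    define x\<^sub>0 where "x\<^sub>0 = max 1 y"
    have x\<^sub>0: "0 < x\<^sub>0" and \<delta>_small: "\<And>j x. 1 \<le> j \<Longrightarrow> x\<^sub>0 \<le> x \<Longrightarrow> \<bar>\<delta> j x\<bar> \<le> \<epsilon>"
      using y by (auto simp: x\<^sub>0_def less_imp_le)
    define a where "a = r x\<^sub>0 * (1 - m)"
    have a: "0 < a" using r_pos[OF x\<^sub>0] m_bounds by (simp add: a_def)
    have "(\<lambda>n. K + exp (- (a * k * ?b n)) / k) \<longlonglongrightarrow> K + 0 / k"
      using a k by (intro tendsto_intros exp_b) auto
    moreover have "K + 0 / k < 1 + e" using e by (simp add: K_def)
    ultimately have up: "eventually (\<lambda>n. K + exp (- (a * k * ?b n)) / k < 1 + e) sequentially"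
      by (rule order_tendstoD)
    have "(\<lambda>n. (1 - exp (- (a * ?b n))) / K) \<longlonglongrightarrow> (1 - 0) / K"
      using a e by (intro tendsto_intros exp_b) (auto simp: K_def)
    \<comment> \<open>The product is \<open>1 - e / 2 - e * e / 2\<close>, so the limit
      \<open>1 / K\<close> of the lower bound exceeds \<open>1 - e\<close>.\<close>
    moreover have "(1 - e) * K < 1" using e by (simp add: K_def algebra_simps add_pos_pos)
    then have "1 - e < (1 - 0) / K" using e by (simp add: K_def field_simps)
    ultimately have low: "eventually (\<lambda>n. 1 - e < (1 - exp (- (a * ?b n))) / K) sequentially"
      by (rule order_tendstoD)
    show "\<forall>\<^sub>F n in sequentially. \<forall>i\<in>{1..n}. \<bar>max_prob P X i n / weight_ratio c i n - 1\<bar> < e"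
      using up low
    proof eventually_elim
      case (elim n)
      show ?case
      proof
        fix i assume "i \<in> {1..n}"
        from bounds[OF \<epsilon> K x\<^sub>0 \<delta>_small this] elim
        show "\<bar>max_prob P X i n / weight_ratio c i n - 1\<bar> < e"
          by (auto simp: a_def abs_less_iff)
      qed
    qed
  qed
qed

end
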